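(* Let $T\in\mathbb{N}$, $\alpha,\beta\in\mathbb{R}$, and let $(y_k)_{k\ge 0}$ be the solution of $$y_{k+1}+y_{k-1}-b_ky_k=0\ (k\ge 1),\qquad y_0=\alpha,\ y_1=\beta .$$ Let $f^T\in\mathcal{F}^T$ be the (unique) control such that $(W^Tf^T)_k=y_k$ for $k=1,\ldots,T$, and let $\varkappa^T$ be the solution of $$\varkappa^T_{t+1}+\varkappa^T_{t-1}=0\ (t=0,\ldots,T),\qquad \varkappa^T_T=0,\ \varkappa^T_{T-1}=1 .$$ Then $f^T$ satisfies the following equation in $\mathcal{F}^T$: $$C^Tf^T=\beta\varkappa^T-\alpha\,(R^T)^*\varkappa^T .$$ Here the term $\beta\varkappa^T$ denotes the vector $\beta(\varkappa^T_0,\ldots,\varkappa^T_{T-1})\in\mathcal{F}^T$, and $(R^T)^*\varkappa^T\in\mathcal{F}^T$ is the vector determined by $$\big((R^T)^*\varkappa^T,g\big)_{\mathcal{F}^T}=\sum_{t=1}^{T}\varkappa^T_t\,(R^Tg)_t\qquad\text{for all } g\in\mathcal{F}^T .$$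
   Context: $\mathbb{N}=\{1,2,\ldots\}$, $\mathbb{N}_0=\mathbb{N}\cup\{0\}$. Fix a real sequence (potential) $(b_1,b_2,\ldots)$. For a real control $f=(f_0,f_1,\ldots)$, $u^f_{n,t}$ denotes the solution of $$u_{n,t+1}+u_{n,t-1}-u_{n+1,t}-u_{n-1,t}+b_nu_{n,t}=0\quad (n\in\mathbb{N},\ t\in\mathbb{N}_0),$$ $$u_{n,-1}=u_{n,0}=0\ (n\in\mathbb{N}),\qquad u_{0,t}=f_t\ (t\in\mathbb{N}_0).$$ $\mathcal{F}^T=\mathbb{R}^T$ is the space of controls $f=(f_0,\ldots,f_{T-1})$ and $\mathcal{H}^T=\mathbb{R}^T$ is the space of vectors $h=(h_1,\ldots,h_T)$, both with the standard inner product. (The values $u^f_{n,t}$ with $n\ge1$, $t\le T$ depend only on $f_0,\ldots,f_{T-1}$.) The response operator $R^T:\mathcal{F}^T\to\mathbb{R}^T$ is $(R^Tf)_t=u^f_{1,t}$, $t=1,\ldots,T$. The control operator $W^T:\mathcal{F}^T\to\mathcal{H}^T$ is $(W^Tf)_n=u^f_{n,T}$, $n=1,\ldots,T$; it is an isomorphism. The connecting operator $C^T:\mathcal{F}^T\to\mathcal{F}^T$ is defined by $(C^Tf,g)_{\mathcal{F}^T}=(W^Tf,W^Tg)_{\mathcal{H}^T}$ for all $f,g\in\mathcal{F}^T$, i.e. $C^T=(W^T)^*W^T$. *)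

theory Defs
  imports "Jordan_Normal_Form.Matrix"
begin

text \<open>
  The potential is \<open>b :: nat \<Rightarrow> real\<close>, of which only \<open>b 1, b 2, \<dots>\<close> is ever used.  Time starts at
  \<open>-1\<close>, so solutions are functions of a natural and an integer; the value at \<open>(0, -1)\<close> is
  irrelevant.
\<close>

definition is_wave_solution ::
  "(nat \<Rightarrow> real) \<Rightarrow> (nat \<Rightarrow> real) \<Rightarrow> (nat \<Rightarrow> int \<Rightarrow> real) \<Rightarrow> bool" where
  "is_wave_solution b f u \<longleftrightarrow>
     (\<forall>n\<ge>1. \<forall>t\<ge>0. u n (t + 1) + u n (t - 1) - u (n + 1) t - u (n - 1) t + b n * u n t = 0) \<and>
     (\<forall>n\<ge>1. u n (-1) = 0 \<and> u n 0 = 0) \<and>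
     (\<forall>t. u 0 (int t) = f t)"

text \<open>
  The values of the solution at times \<open>t \<ge> 0\<close>, obtained by solving the equation for \<open>u\<close> at
  time \<open>t + 1\<close>.  The lemmas \<open>wave_is_solution\<close> and \<open>wave_unique\<close> state that this is
  the unique solution of the initial boundary value problem.
\<close>

function wave :: "(nat \<Rightarrow> real) \<Rightarrow> (nat \<Rightarrow> real) \<Rightarrow> nat \<Rightarrow> nat \<Rightarrow> real" where
  "wave b f 0 t = f t"
| "wave b f (Suc n) 0 = 0"
| "wave b f (Suc n) (Suc t) =
     wave b f (Suc (Suc n)) t + wave b f n t - b (Suc n) * wave b f (Suc n) t
       - (if t = 0 then 0 else wave b f (Suc n) (t - 1))"
  by pat_completeness auto
termination by (relation "measure (\<lambda>(b, f, n, t). t)") auto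

lemma wave_is_solution:
  "is_wave_solution b f (\<lambda>n t. if t < 0 then 0 else wave b f n (nat t))"
  unfolding is_wave_solution_def
proof (intro conjI allI impI)
  fix n :: nat and t :: int
  assume n: "n \<ge> 1" and t: "t \<ge> 0"
  obtain m where m: "n = Suc m" using n by (cases n) auto
  obtain s where s: "t = int s" using t by (metis nonneg_int_cases)
  have e: "nat (int s + 1) = Suc s" "nat (int s - 1) = s - 1" by auto
  show "(if t + 1 < 0 then 0 else wave b f n (nat (t + 1))) +
        (if t - 1 < 0 then 0 else wave b f n (nat (t - 1))) -
        (if t < 0 then 0 else wave b f (n + 1) (nat t)) -
        (if t < 0 then 0 else wave b f (n - 1) (nat t)) +
        b n * (if t < 0 then 0 else wave b f n (nat t)) = 0"
    unfolding m s e by (cases "s = 0") (auto simp: algebra_simps)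
next
  fix n :: nat
  assume "n \<ge> 1"
  then show "(if (0::int) < 0 then 0 else wave b f n (nat 0)) = 0" by (cases n) auto
qed auto

lemma wave_unique:
  assumes "is_wave_solution b f u"
  shows "u n (int t) = wave b f n t"
proof -
  have eq: "u n (t + 1) = u (n + 1) t + u (n - 1) t - b n * u n t - u n (t - 1)"
    if "n \<ge> 1" "t \<ge> 0" for n t
  proof -
    have "u n (t + 1) + u n (t - 1) - u (n + 1) t - u (n - 1) t + b n * u n t = 0"
      using assms that by (auto simp: is_wave_solution_def)
    then show ?thesis by linarith
  qed
  have ini: "u (Suc n) (-1) = 0" "u (Suc n) 0 = 0" "u 0 (int s) = f s" for n s
    using assms by (auto simp: is_wave_solution_def)
  show ?thesis
  proof (induction b \<equiv> b f \<equiv> f n t rule: wave.induct)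
    case (3 n t)
    have "u (Suc n) (int t - 1) = (if t = 0 then 0 else wave b f (Suc n) (t - 1))"
      using 3 ini by (cases t) auto
    then show ?case using eq[of "Suc n" "int t"] 3 by (simp add: add.commute)
  qed (auto simp: ini)
qed

text \<open>
  Vectors of length \<open>T\<close> are \<open>carrier_vec T\<close>, indexed from \<open>0\<close>.  A control
  \<open>(f\<^sub>0, \<dots>, f\<^sub>T\<^sub>-\<^sub>1)\<close> has entries \<open>f $ t\<close>, while for the state \<open>(h\<^sub>1, \<dots>, h\<^sub>T)\<close> and the
  response, indexed by \<open>1, \<dots>, T\<close>, the entry with index \<open>k\<close> is \<open>h $ (k - 1)\<close>.  Finite controls
  are extended by zero; by \<open>wave_cong\<close> the extension does not matter.
\<close>

definition control_seq :: "nat \<Rightarrow> real vec \<Rightarrow> nat \<Rightarrow> real" where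
  "control_seq T f = (\<lambda>t. if t < T then f $ t else 0)"

definition response_op :: "(nat \<Rightarrow> real) \<Rightarrow> nat \<Rightarrow> real vec \<Rightarrow> real vec" where
  "response_op b T f = vec T (\<lambda>i. wave b (control_seq T f) 1 (i + 1))"

definition control_op :: "(nat \<Rightarrow> real) \<Rightarrow> nat \<Rightarrow> real vec \<Rightarrow> real vec" where
  "control_op b T f = vec T (\<lambda>i. wave b (control_seq T f) (i + 1) T)"

text \<open>
  For linear \<open>A\<close> defined on \<open>carrier_vec T\<close>.  The vector described exists for the two operators
  it is used with: see \<open>op_adjoint_response_op\<close> and \<open>connecting_op\<close>.
\<close>

definition op_adjoint :: "nat \<Rightarrow> (real vec \<Rightarrow> real vec) \<Rightarrow> real vec \<Rightarrow> real vec" where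
  "op_adjoint T A v =
     (THE h. h \<in> carrier_vec T \<and> (\<forall>g\<in>carrier_vec T. h \<bullet> g = v \<bullet> A g))"

definition connecting_op :: "(nat \<Rightarrow> real) \<Rightarrow> nat \<Rightarrow> real vec \<Rightarrow> real vec" where
  "connecting_op b T f = op_adjoint T (control_op b T) (control_op b T f)"

lemma wave_triangular:
  assumes "\<And>s. s + n < t \<Longrightarrow> f s = g s"
  shows "wave b f n t - wave b g n t = (if n \<le> t then f (t - n) - g (t - n) else 0)"
  using assms
proof (induction b f n t rule: wave.induct)
  case (3 b f n t)
  have i1: "wave b f n t - wave b g n t = (if n \<le> t then f (t - n) - g (t - n) else 0)"
    using 3 by auto
  have i2: "wave b f (Suc (Suc n)) t = wave b g (Suc (Suc n)) t"
    using "3.IH"(1) "3.prems" by (auto split: if_splits)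
  have i3: "wave b f (Suc n) t = wave b g (Suc n) t"
    using "3.IH"(3) "3.prems" by (auto split: if_splits)
  have i4: "wave b f (Suc n) (t - 1) = wave b g (Suc n) (t - 1)" if "t \<noteq> 0"
    using "3.IH"(4) "3.prems" that by (auto split: if_splits)
  show ?case using i1 i2 i3 i4 by auto
qed auto

lemma wave_cong:
  assumes "n \<ge> 1" "t \<le> T" "\<And>s. s < T \<Longrightarrow> f s = g s"
  shows "wave b f n t = wave b g n t"
proof -
  have "wave b f n t - wave b g n t = (if n \<le> t then f (t - n) - g (t - n) else 0)"
    by (rule wave_triangular) (use assms in auto)
  then show ?thesis using assms by (auto split: if_splits)
qed

lemma wave_linear:
  "wave b (\<lambda>t. c * f t + d * g t) n t = c * wave b f n t + d * wave b g n t"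
  by (induction b f n t rule: wave.induct) (auto simp: algebra_simps)

lemma wave_sum:
  "finite I \<Longrightarrow> wave b (\<lambda>t. \<Sum>i\<in>I. c i * f i t) n t = (\<Sum>i\<in>I. c i * wave b (f i) n t)"
proof (induction I rule: finite_induct)
  case empty
  show ?case using wave_linear[of b 0 "\<lambda>_. 0" 0 "\<lambda>_. 0" n t] by simp
next
  case (insert j I)
  then show ?case
    using wave_linear[of b "c j" "f j" 1 "\<lambda>t. \<Sum>i\<in>I. c i * f i t" n t] by simp
qed

lemma op_adjoint_equality:
  assumes "h \<in> carrier_vec T" "\<And>g. g \<in> carrier_vec T \<Longrightarrow> h \<bullet> g = v \<bullet> A g"
  shows "op_adjoint T A v = h"
  unfolding op_adjoint_def
proof (rule the_equality)
  fix k assume k: "k \<in> carrier_vec T \<and> (\<forall>g\<in>carrier_vec T. k \<bullet> g = v \<bullet> A g)"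
  show "k = h"
  proof (rule eq_vecI)
    fix i assume i: "i < dim_vec h"
    have "k \<bullet> unit_vec T i = h \<bullet> unit_vec T i" using k assms by simp
    then show "k $ i = h $ i"
      using k assms(1) i by (simp only: carrier_vecD scalar_prod_right_unit)
  qed (use k assms in auto)
qed (use assms in auto)

lemma op_adjoint_wave:
  fixes b :: "nat \<Rightarrow> real" and T :: nat and p q :: "nat \<Rightarrow> nat"
  defines "A \<equiv> (\<lambda>g. vec T (\<lambda>i. wave b (control_seq T g) (p i) (q i)))"
  shows "op_adjoint T A v \<in> carrier_vec T"
    and "g \<in> carrier_vec T \<Longrightarrow> op_adjoint T A v \<bullet> g = v \<bullet> A g"
proof -
  define h where "h = vec T (\<lambda>j. v \<bullet> A (unit_vec T j))"
  have h: "h \<in> carrier_vec T" by (simp add: h_def)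
  have hg: "h \<bullet> g = v \<bullet> A g" if g: "g \<in> carrier_vec T" for g
  proof -
    have "control_seq T g = (\<lambda>t. \<Sum>j<T. g $ j * control_seq T (unit_vec T j) t)"
    proof
      fix t
      have "(\<Sum>j<T. g $ j * control_seq T (unit_vec T j) t) =
          (\<Sum>j<T. if j = t then g $ j else 0)"
        by (rule sum.cong) (auto simp: control_seq_def unit_vec_def)
      then show "control_seq T g t = (\<Sum>j<T. g $ j * control_seq T (unit_vec T j) t)"
        by (simp add: control_seq_def)
    qed
    then have w: "wave b (control_seq T g) n t =
        (\<Sum>j<T. g $ j * wave b (control_seq T (unit_vec T j)) n t)" for n t
      using wave_sum[of "{..<T}" b "\<lambda>j. g $ j" "\<lambda>j. control_seq T (unit_vec T j)" n t] by simp
    have "v \<bullet> A g = (\<Sum>i<T. \<Sum>j<T. v $ i * (g $ j * A (unit_vec T j) $ i))"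
      by (simp add: scalar_prod_def A_def w sum_distrib_left atLeast0LessThan)
    also have "\<dots> = (\<Sum>j<T. \<Sum>i<T. v $ i * (g $ j * A (unit_vec T j) $ i))"
      by (rule sum.swap)
    also have "\<dots> = h \<bullet> g"
      using g by (simp add: scalar_prod_def h_def A_def sum_distrib_left sum_distrib_right
          atLeast0LessThan mult_ac)
    finally show ?thesis by simp
  qed
  have eq: "op_adjoint T A v = h" by (rule op_adjoint_equality[OF h hg])
  show "op_adjoint T A v \<in> carrier_vec T" by (simp add: eq h)
  show "g \<in> carrier_vec T \<Longrightarrow> op_adjoint T A v \<bullet> g = v \<bullet> A g" by (simp add: eq hg)
qed

lemma op_adjoint_response_op:
  "op_adjoint T (response_op b T) v \<in> carrier_vec T"
  "g \<in> carrier_vec T \<Longrightarrow> op_adjoint T (response_op b T) v \<bullet> g = v \<bullet> response_op b T g"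
  using op_adjoint_wave[where b = b and T = T and p = "\<lambda>_. 1" and q = "\<lambda>i. i + 1"] by (simp_all add: response_op_def[abs_def])

lemma connecting_op:
  "connecting_op b T f \<in> carrier_vec T"
  "g \<in> carrier_vec T \<Longrightarrow> connecting_op b T f \<bullet> g = control_op b T f \<bullet> control_op b T g"
  using op_adjoint_wave[where b = b and T = T and p = "\<lambda>i. i + 1" and q = "\<lambda>_. T"]
  by (simp_all add: connecting_op_def control_op_def[abs_def])

lemma control_op_bij: "bij_betw (control_op b T) (carrier_vec T) (carrier_vec T)"
proof (rule bij_betwI')
  fix f g :: "real vec" assume fg: "f \<in> carrier_vec T" "g \<in> carrier_vec T"
  show "(control_op b T f = control_op b T g) = (f = g)"
  proof
    assume eq: "control_op b T f = control_op b T g"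
    have "s < T \<Longrightarrow> f $ s = g $ s" for s
    proof (induction s rule: less_induct)
      case (less s)
      have "wave b (control_seq T f) (T - s) T - wave b (control_seq T g) (T - s) T =
          control_seq T f s - control_seq T g s"
        using wave_triangular[of "T - s" T "control_seq T f" "control_seq T g" b] less
        by (auto simp: control_seq_def)
      moreover have "control_op b T f $ (T - s - 1) = control_op b T g $ (T - s - 1)"
        by (simp add: eq)
      then have "wave b (control_seq T f) (T - s) T = wave b (control_seq T g) (T - s) T"
        using less by (simp add: control_op_def Suc_diff_Suc)
      ultimately show ?case using less by (simp add: control_seq_def)
    qed
    then show "f = g" using fg by auto
  qed simp
next
  fix f :: "real vec" show "control_op b T f \<in> carrier_vec T" by (simp add: control_op_def)
next
  fix h :: "real vec" assume h: "h \<in> carrier_vec T"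
  have "m \<le> T \<Longrightarrow> \<exists>f. \<forall>n. T - m < n \<and> n \<le> T \<longrightarrow> wave b f n T = h $ (n - 1)" for m
  proof (induction m)
    case (Suc m)
    then obtain f where f: "\<And>n. T - m < n \<Longrightarrow> n \<le> T \<Longrightarrow> wave b f n T = h $ (n - 1)" by auto
    define g where "g = f(m := f m + h $ (T - m - 1) - wave b f (T - m) T)"
    have d: "wave b g n T - wave b f n T = (if n \<le> T then g (T - n) - f (T - n) else 0)"
      if "T - m \<le> n" for n
      by (rule wave_triangular) (use that in \<open>auto simp: g_def\<close>)
    have "wave b g n T = h $ (n - 1)" if "T - Suc m < n" "n \<le> T" for n
    proof (cases "n = T - m")
      case True
      then show ?thesis using d[of n] Suc.prems by (auto simp: g_def)
    next
      case False
      then have n: "T - m < n" using that by linarith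
      then have "T - n \<noteq> m" using that by linarith
      then show ?thesis using d[of n] f[OF n] n that by (auto simp: g_def)
    qed
    then show ?case by blast
  qed auto
  from this[of T] obtain f where f: "\<And>n. 0 < n \<Longrightarrow> n \<le> T \<Longrightarrow> wave b f n T = h $ (n - 1)" by auto
  have "control_op b T (vec T f) = h"
  proof (rule eq_vecI)
    fix i assume i: "i < dim_vec h"
    have "wave b (control_seq T (vec T f)) (i + 1) T = wave b f (i + 1) T"
      by (rule wave_cong) (auto simp: control_seq_def)
    then show "control_op b T (vec T f) $ i = h $ i" using f[of "i + 1"] h i
      by (simp add: control_op_def)
  qed (use h in \<open>auto simp: control_op_def\<close>)
  then show "\<exists>f\<in>carrier_vec T. h = control_op b T f" by (metis vec_carrier)
qed

end

theory Submission
  imports Defs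
begin

text \<open>
  The proof pairs the wave with the stationary solution \<open>y\<close>. For a control \<open>g\<close> with solution
  \<open>u\<close>, put \<open>P t = \<Sum>k=1..T. y\<^sub>k u\<^sub>k\<^sub>,\<^sub>t\<close>. The spatial part of the wave equation is
  the symmetric operator that annihilates \<open>y\<close>, so Lagrange's identity leaves only boundary
  terms: those at \<open>k = 0\<close> give
  \[ P_{t+1} + P_{t-1} = \beta g_t - \alpha u_{1,t} \quad (0 \le t < T), \qquad P_0 = P_{-1} = 0, \]
  while those at \<open>k = T\<close> vanish because the wave moves with unit speed and has not arrived there
  before time \<open>T\<close> (\<open>weighted_wave_sum_recurrence\<close>).

  This is an ordinary recurrence in \<open>t\<close>, and \<open>\<kappa>\<close> solves its adjoint homogeneous equation
  with final data chosen to select \<open>P\<^sub>T\<close>. Summation by parts in time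
  (\<open>sum_times_oscillator\<close>) therefore yields
  \[ P_T = \sum_{t<T} \kappa_t (\beta g_t - \alpha u_{1,t}). \]
  The left-hand side is the inner product of \<open>W f\<close> with \<open>W g\<close>, because \<open>W f\<close> is the
  restriction of \<open>y\<close>. Since \<open>u\<^sub>1\<^sub>,\<^sub>0 = 0\<close> and \<open>\<kappa>\<^sub>T = 0\<close>, the sum of the
  \<open>\<kappa>\<^sub>t u\<^sub>1\<^sub>,\<^sub>t\<close> may be taken over \<open>t = 1, \<dots>, T\<close>, which makes it the inner product of
  \<open>\<kappa>\<close> with the response to \<open>g\<close>. As \<open>g\<close> is arbitrary, this determines the vector
  \<open>C f\<close>.
\<close>

text \<open>
  Finite speed of propagation: a disturbance starting at \<open>n = 0\<close> advances one site per step.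
\<close>

lemma wave_zero_ahead_of_front: "t < n \<Longrightarrow> wave b f n t = 0"
  by (induction b f n t rule: wave.induct) auto

text \<open>
  Lagrange's identity for the second difference operator: the right-hand side is the difference
  of the Wronskians of \<open>y\<close> and \<open>u\<close> at the two ends of the interval.
\<close>

lemma lagrange_identity:
  fixes b y u :: "nat \<Rightarrow> 'a :: comm_ring_1"
  assumes y: "\<And>k. k \<ge> 1 \<Longrightarrow> y (k + 1) + y (k - 1) - b k * y k = 0"
  shows "(\<Sum>k<N. y (Suc k) * (u (Suc (Suc k)) + u k - b (Suc k) * u (Suc k)))
           = (y 1 * u 0 - y 0 * u 1) - (y (Suc N) * u N - y N * u (Suc N))"
proof (induction N)
  case (Suc N)
  have step: "y (Suc (Suc N)) = b (Suc N) * y (Suc N) - y N"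
    using y[of "Suc N"] by (simp add: algebra_simps add_eq_0_iff)
  show ?case unfolding sum.lessThan_Suc Suc.IH step by (simp add: algebra_simps)
qed simp

text \<open>
  Summation by parts for \<open>P (t + 1) + P (t - 1) = F t\<close> against a solution of the homogeneous
  equation. The value \<open>P (-1) = 0\<close> is built into the initial condition \<open>P 1 = F 0\<close>.
\<close>

lemma sum_times_oscillator:
  fixes \<kappa> P F :: "nat \<Rightarrow> 'a :: comm_ring_1"
  assumes "P 0 = 0" and "P 1 = F 0"
    and "\<And>t. t < m \<Longrightarrow> P (Suc (Suc t)) + P t = F (Suc t)"
    and "\<And>t. t < m \<Longrightarrow> \<kappa> (Suc (Suc t)) + \<kappa> t = 0"
  shows "(\<Sum>t<Suc m. \<kappa> t * F t) = \<kappa> m * P (Suc m) - \<kappa> (Suc m) * P m"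
  using assms(3,4)
proof (induction m)
  case 0
  then show ?case using assms(1,2) by simp
next
  case (Suc m)
  have F: "F (Suc m) = P (Suc (Suc m)) + P m" using Suc.prems(1)[of m] by simp
  have \<kappa>: "\<kappa> (Suc (Suc m)) = - \<kappa> m" using Suc.prems(2)[of m] by (simp add: add_eq_0_iff2)
  have "(\<Sum>t<Suc (Suc m). \<kappa> t * F t) =
      \<kappa> m * P (Suc m) - \<kappa> (Suc m) * P m + \<kappa> (Suc m) * F (Suc m)"
    using Suc.IH Suc.prems by simp
  then show ?case by (simp add: F \<kappa> algebra_simps)
qed

text \<open>
  Summing the wave equation against \<open>y\<close> removes the space variable. The bound \<open>t < N\<close> keeps
  the wave away from the right end, so that the Wronskian there is zero.
\<close>

lemma weighted_wave_sum_recurrence: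
  fixes b f y :: "nat \<Rightarrow> real" and N :: nat
  defines "P \<equiv> (\<lambda>t. \<Sum>k<N. y (Suc k) * wave b f (Suc k) t)"
  assumes y: "\<And>k. k \<ge> 1 \<Longrightarrow> y (k + 1) + y (k - 1) - b k * y k = 0"
    and t: "t < N"
  shows "P (Suc t) + (if t = 0 then 0 else P (t - 1)) = y 1 * f t - y 0 * wave b f 1 t"
proof -
  have "P (Suc t) + (if t = 0 then 0 else P (t - 1)) =
      (\<Sum>k<N. y (Suc k) * (wave b f (Suc (Suc k)) t + wave b f k t
         - b (Suc k) * wave b f (Suc k) t))"
    by (auto simp: P_def sum.distrib[symmetric] algebra_simps intro!: sum.cong)
  also have "\<dots> = y 1 * wave b f 0 t - y 0 * wave b f 1 t
      - (y (Suc N) * wave b f N t - y N * wave b f (Suc N) t)"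
    by (rule lagrange_identity[OF y])
  also have "\<dots> = y 1 * f t - y 0 * wave b f 1 t"
    using t by (simp add: wave_zero_ahead_of_front)
  finally show ?thesis .
qed

theorem theorem3:
  fixes b :: "nat \<Rightarrow> real" and T :: nat and \<alpha> \<beta> :: real
    and y :: "nat \<Rightarrow> real" and f :: "real vec" and \<kappa> :: "int \<Rightarrow> real"
  assumes "T \<ge> 1"
    and "\<And>k. k \<ge> 1 \<Longrightarrow> y (k + 1) + y (k - 1) - b k * y k = 0"
    and "y 0 = \<alpha>" and "y 1 = \<beta>"
    and "f \<in> carrier_vec T" and "control_op b T f = vec T (\<lambda>i. y (i + 1))"
    and "\<And>t. t \<in> {0..int T} \<Longrightarrow> \<kappa> (t + 1) + \<kappa> (t - 1) = 0"
    and "\<kappa> (int T) = 0" and "\<kappa> (int T - 1) = 1"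
  shows "connecting_op b T f =
           \<beta> \<cdot>\<^sub>v vec T (\<lambda>i. \<kappa> (int i))
           - \<alpha> \<cdot>\<^sub>v op_adjoint T (response_op b T) (vec T (\<lambda>i. \<kappa> (int (i + 1))))"
proof -
  define v where "v = vec T (\<lambda>i. \<kappa> (int i))"
  define r where "r = vec T (\<lambda>i. \<kappa> (int (i + 1)))"
  define R' where "R' = op_adjoint T (response_op b T) r"
  have v: "v \<in> carrier_vec T" and R': "R' \<in> carrier_vec T"
    by (simp_all add: v_def R'_def op_adjoint_response_op)
  obtain m where m: "T = Suc m" using \<open>T \<ge> 1\<close> by (cases T) auto
  have "(\<beta> \<cdot>\<^sub>v v - \<alpha> \<cdot>\<^sub>v R') \<bullet> g = control_op b T f \<bullet> control_op b T g"
    if g: "g \<in> carrier_vec T" for g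
  proof -
    define w where "w = wave b (control_seq T g)"
    define P where "P t = (\<Sum>k<T. y (Suc k) * w (Suc k) t)" for t
    define F where "F t = \<beta> * control_seq T g t - \<alpha> * w 1 t" for t
    have rec: "P (Suc t) + (if t = 0 then 0 else P (t - 1)) = F t" if "t < T" for t
      using weighted_wave_sum_recurrence[of y b t T "control_seq T g", OF assms(2) that]
      by (simp only: P_def F_def w_def assms(3,4))
    have "(\<Sum>t<Suc m. \<kappa> (int t) * F t) = \<kappa> (int m) * P (Suc m) - \<kappa> (int (Suc m)) * P m"
    proof (rule sum_times_oscillator)
      show "P 0 = 0" by (simp add: P_def w_def)
      show "P 1 = F 0" using rec[of 0] by (simp add: m)
      show "P (Suc (Suc t)) + P t = F (Suc t)" if "t < m" for t
        using rec[of "Suc t"] that by (simp add: m)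
      show "\<kappa> (int (Suc (Suc t))) + \<kappa> (int t) = 0" if "t < m" for t
        using assms(7)[of "int (Suc t)"] that by (simp add: m add.commute)
    qed
    then have PT: "P T = (\<Sum>t<T. \<kappa> (int t) * F t)"
      using assms(8,9) by (simp add: m)
    \<comment> \<open>Both end terms of this shift vanish: \<open>w 1 0 = 0\<close> and \<open>\<kappa> T = 0\<close>.\<close>
    have "(\<Sum>t<T. \<kappa> (int t) * w 1 t) = (\<Sum>t<Suc T. \<kappa> (int t) * w 1 t)"
      using assms(8) by simp
    also have "\<dots> = (\<Sum>t<T. \<kappa> (int (t + 1)) * w 1 (t + 1))"
      unfolding sum.lessThan_Suc_shift by (simp add: w_def)
    also have "\<dots> = r \<bullet> response_op b T g"
      by (simp add: scalar_prod_def r_def response_op_def w_def atLeast0LessThan)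
    also have "\<dots> = R' \<bullet> g"
      using op_adjoint_response_op(2)[OF g] by (simp add: R'_def)
    finally have resp: "(\<Sum>t<T. \<kappa> (int t) * w 1 t) = R' \<bullet> g" .
    have ctrl: "(\<Sum>t<T. \<kappa> (int t) * control_seq T g t) = v \<bullet> g"
      using g by (simp add: scalar_prod_def v_def control_seq_def atLeast0LessThan)
    have "control_op b T f \<bullet> control_op b T g = P T"
      unfolding assms(6)
      by (simp add: scalar_prod_def control_op_def P_def w_def atLeast0LessThan)
    also have "\<dots> = \<beta> * (v \<bullet> g) - \<alpha> * (R' \<bullet> g)"
      unfolding PT ctrl[symmetric] resp[symmetric]
      by (simp add: F_def sum_distrib_left sum_subtractf algebra_simps)
    also have "\<dots> = (\<beta> \<cdot>\<^sub>v v - \<alpha> \<cdot>\<^sub>v R') \<bullet> g"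
      using v R' g by (simp add: minus_scalar_prod_distrib[where n = T])
    finally show ?thesis by simp
  qed
  then have "connecting_op b T f = \<beta> \<cdot>\<^sub>v v - \<alpha> \<cdot>\<^sub>v R'"
    unfolding connecting_op_def using v R' by (intro op_adjoint_equality) auto
  then show ?thesis by (simp add: v_def R'_def r_def)
qed

end
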